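(* Let $n\ge 3$ be an integer, $G=\mathbb{Z}/n\mathbb{Z}$, $N=\Big\lfloor \frac{n-\frac14}{2}\Big\rfloor$, and let $V\in\mathbf{M}_N$ be the discrete sine transform matrix $$[V]_{j,k}=\frac{2}{\mathrm{i}\sqrt n}\sin\Big(\frac{2\pi jk}{n}\Big),\qquad 1\le j,k\le N,$$ where $\mathrm{i}$ is the imaginary unit. Let $\mathcal{A}$ be the algebra of all matrices in $\mathbf{M}_N$ that are diagonalized by $V$. (1) The most general $S\in\mathbf{M}_N$ diagonalized by $V$ is given by $$[S]_{j,k}=\sum_{\ell=1}^{\min(j,k)}\operatorname{sgn}\big(\tfrac n2-|k-j|-2\ell+1\big)\,s_{\min(n-|k-j|-2\ell+1,\;|k-j|+2\ell-1)},\qquad 1\le j,k\le N,$$ in which $s_0=0$ and $s_1,s_2,\ldots,s_N\in\mathbb{C}$ are free parameters that correspond, in that order, to the entries in the first row of $S$ (a term whose $\operatorname{sgn}$ factor is $0$ is $0$). For $i=1,2,\ldots,N$, the matrices $S_i$ obtained by setting $s_j=\delta_{i,j}$ ($1\le j\le N$) in this formula form a basis for $\mathcal{A}$. In particular, $S_1=I$. (2) Let $x_{i,j}=1$ if $j\in X_i$ and $0$ otherwise. The matrices $T_1,T_2,\ldots,T_N\in\mathbf{M}_N$ defined by $$[T_i]_{j,k}=x_{i,j-k}-x_{i,j+k},\qquad 1\le j,k\le N,$$ are real, symmetric, and satisfy $T_i=VD_iV^*$, in which $$D_i=2\operatorname{diag}\big(\cos\tfrac{2\pi i}{n},\cos\tfrac{4\pi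 i}{n},\ldots,\cos\tfrac{2\pi Ni}{n}\big)\in\mathbf{M}_N$$ (here $i$ is the index of $T_i$). Moreover, $T_i$ generates $\mathcal{A}$ if and only if $i$ is relatively prime to $n$. (3) If $n$ is odd, then $\{T_1,T_2,\ldots,T_N\}$ is a basis for $\mathcal{A}$. Another formula for the entries of a general $T\in\mathcal{A}$ is given by $$[T]_{j,k}=t_{\min(n-j-k,\;j+k)}-t_{\min(n-|j-k|,\;|j-k|)},\qquad 1\le j,k\le N,$$ in which $t_0=0$ and $t_1,t_2,\ldots,t_N\in\mathbb{C}$ are free parameters.
   Context: $\mathbf{M}_N$ denotes the set of $N\times N$ complex matrices. Thus $N=\frac n2-1$ if $n$ is even and $N=\frac{n-1}{2}$ if $n$ is odd. For $i=1,\ldots,N$, $X_i=\{i,-i\}\subseteq G=\mathbb{Z}/n\mathbb{Z}$; in $x_{i,j}$ the second index $j$ is read as an element of $G$ (i.e. modulo $n$). $\operatorname{sgn}x$ denotes the sign of $x$, with $\operatorname{sgn}0=0$; $\delta_{i,j}$ is the Kronecker delta. The matrix $V$ is unitary and symmetric. A matrix $S$ is diagonalized by $V$ if $V^*SV$ is diagonal. "$T_i$ generates $\mathcal{A}$" means generates it as a unital algebra, i.e. every element of $\mathcal{A}$ is a polynomial in $T_i$ (constant term multiplying the identity). "Most general" / "general" with free parameters means that the matrices in $\mathcal{A}$ are exactly those of the given form as the parameters range over $\mathbb{C}$. *)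

theory Defs
  imports Jordan_Normal_Form.Schur_Decomposition
begin

text \<open>The type of matrices is \<open>complex mat\<close>, whose indices start at 0; \<open>mat1 N f\<close> is the
  \<open>N \<times> N\<close> matrix whose entry in row \<open>j\<close> and column \<open>k\<close>, counted from 1, is \<open>f j k\<close>.\<close>

definition mat1 :: "nat \<Rightarrow> (nat \<Rightarrow> nat \<Rightarrow> complex) \<Rightarrow> complex mat" where
  "mat1 N f = mat N N (\<lambda>(j, k). f (Suc j) (Suc k))"

definition dst_dim :: "nat \<Rightarrow> nat" where
  "dst_dim n = nat \<lfloor>(real n - 1 / 4) / 2\<rfloor>"

definition dst_mat :: "nat \<Rightarrow> complex mat" where
  "dst_mat n = mat1 (dst_dim n) (\<lambda>j k.
     2 / (\<i> * complex_of_real (sqrt (real n))) *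
     complex_of_real (sin (2 * pi * real j * real k / real n)))"

definition dst_algebra :: "nat \<Rightarrow> complex mat set" where
  "dst_algebra n = {S \<in> carrier_mat (dst_dim n) (dst_dim n).
     diagonal_mat (mat_adjoint (dst_mat n) * S * dst_mat n)}"

text \<open>The index of \<open>s\<close> is computed in \<open>int\<close> to avoid truncated subtraction. For even \<open>n\<close> it may be
  \<open>n div 2 = dst_dim n + 1\<close>, but only where the sign factor is 0; in all other terms it lies
  between 1 and \<open>dst_dim n\<close>.\<close>

definition dst_S :: "nat \<Rightarrow> (nat \<Rightarrow> complex) \<Rightarrow> complex mat" where
  "dst_S n s = mat1 (dst_dim n) (\<lambda>j k. \<Sum>l = 1..min j k.
     complex_of_real (sgn (real n / 2 - \<bar>real k - real j\<bar> - 2 * real l + 1)) *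
     s (nat (min (int n - \<bar>int k - int j\<bar> - 2 * int l + 1) (\<bar>int k - int j\<bar> + 2 * int l - 1))))"

text \<open>Elements of \<open>\<int>/n\<int>\<close> are represented by their residues in \<open>{0..<n}\<close>.\<close>

definition dst_X :: "nat \<Rightarrow> nat \<Rightarrow> int set" where
  "dst_X n i = {int i mod int n, (- int i) mod int n}"

definition dst_x :: "nat \<Rightarrow> nat \<Rightarrow> int \<Rightarrow> complex" where
  "dst_x n i j = (if j mod int n \<in> dst_X n i then 1 else 0)"

definition dst_T :: "nat \<Rightarrow> nat \<Rightarrow> complex mat" where
  "dst_T n i = mat1 (dst_dim n) (\<lambda>j k.
     dst_x n i (int j - int k) - dst_x n i (int j + int k))"

definition dst_D :: "nat \<Rightarrow> nat \<Rightarrow> complex mat" where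
  "dst_D n i = 2 \<cdot>\<^sub>m mat_diag (dst_dim n)
     (\<lambda>k. complex_of_real (cos (2 * pi * real i * real (Suc k) / real n)))"

definition dst_general_T :: "nat \<Rightarrow> (nat \<Rightarrow> complex) \<Rightarrow> complex mat" where
  "dst_general_T n t = mat1 (dst_dim n) (\<lambda>j k.
     t (nat (min (int n - int j - int k) (int j + int k))) -
     t (nat (min (int n - \<bar>int j - int k\<bar>) \<bar>int j - int k\<bar>)))"

text \<open>The unital algebra generated by \<open>T\<close>, i.e. the set of all polynomials in \<open>T\<close>.\<close>

definition generated_algebra :: "nat \<Rightarrow> complex mat \<Rightarrow> complex mat set" where
  "generated_algebra N T =
     {\<Oplus>\<^bsub>module_mat TYPE(complex) N N\<^esub> m \<in> {..Polynomial.degree p}.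
       Polynomial.coeff p m \<cdot>\<^sub>m (T ^\<^sub>m m) |p :: complex poly. True}"

text \<open>Injectivity is required because a basis is understood as a family.\<close>

definition dst_algebra_basis :: "nat \<Rightarrow> (nat \<Rightarrow> complex mat) \<Rightarrow> bool" where
  "dst_algebra_basis n F \<longleftrightarrow> inj_on F {1..dst_dim n} \<and>
     vectorspace.basis class_ring
       (module_mat TYPE(complex) (dst_dim n) (dst_dim n)\<lparr>carrier := dst_algebra n\<rparr>)
       (F ` {1..dst_dim n})"

lemma diagonal_mat_add:
  assumes "A \<in> carrier_mat N N" "B \<in> carrier_mat N N" "diagonal_mat A" "diagonal_mat B"
  shows "diagonal_mat (A + B :: complex mat)"
  using assms by (auto simp: diagonal_mat_def)

lemma diagonal_mat_smult:
  "diagonal_mat A \<Longrightarrow> diagonal_mat (c \<cdot>\<^sub>m A :: complex mat)"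
  by (auto simp: diagonal_mat_def)

text \<open>\<open>vectorspace.basis\<close> is used for an actual vector space.\<close>

lemma dst_algebra_vectorspace:
  "vectorspace (class_ring :: complex ring)
     (module_mat TYPE(complex) (dst_dim n) (dst_dim n)\<lparr>carrier := dst_algebra n\<rparr>)"
proof -
  let ?N = "dst_dim n" and ?V = "dst_mat n"
  interpret matrix_vs ?N ?N "TYPE(complex)" .
  have V: "?V \<in> carrier_mat ?N ?N"
    by (simp add: dst_mat_def mat1_def)
  then have U: "mat_adjoint ?V \<in> carrier_mat ?N ?N"
    by (auto simp: mat_adjoint_def mat_of_rows_def)
  have add: "A + B \<in> dst_algebra n" if "A \<in> dst_algebra n" "B \<in> dst_algebra n" for A B
  proof -
    have AB: "A \<in> carrier_mat ?N ?N" "B \<in> carrier_mat ?N ?N"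
      using that by (auto simp: dst_algebra_def)
    have "mat_adjoint ?V * (A + B) * ?V = mat_adjoint ?V * A * ?V + mat_adjoint ?V * B * ?V"
      using U V AB by (simp del: assoc_mult_mat add: mult_add_distrib_mat[OF U] add_mult_distrib_mat[of _ ?N ?N])
    moreover have "diagonal_mat (mat_adjoint ?V * A * ?V + mat_adjoint ?V * B * ?V)"
      using that U V AB by (intro diagonal_mat_add[of _ ?N]) (simp_all add: dst_algebra_def)
    ultimately show ?thesis
      using AB by (simp add: dst_algebra_def)
  qed
  have smult: "c \<cdot>\<^sub>m A \<in> dst_algebra n" if "A \<in> dst_algebra n" for c A
  proof -
    have A: "A \<in> carrier_mat ?N ?N"
      using that by (auto simp: dst_algebra_def)
    have "mat_adjoint ?V * (c \<cdot>\<^sub>m A) * ?V = c \<cdot>\<^sub>m (mat_adjoint ?V * A * ?V)"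
      using U V A by (simp del: assoc_mult_mat add: mult_smult_distrib[OF U A] mult_smult_assoc_mat[of _ ?N ?N])
    moreover have "diagonal_mat (c \<cdot>\<^sub>m (mat_adjoint ?V * A * ?V))"
      using that by (intro diagonal_mat_smult) (simp add: dst_algebra_def)
    ultimately show ?thesis
      using A by (simp add: dst_algebra_def)
  qed
  have zero: "0\<^sub>m ?N ?N \<in> dst_algebra n"
    using U V by (auto simp: dst_algebra_def diagonal_mat_def)
  have "submodule class_ring (dst_algebra n) V"
    by (unfold_locales)
      (use add smult zero in \<open>auto simp: dst_algebra_def module_mat_simps\<close>)
  then have "VectorSpace.subspace class_ring (dst_algebra n) V"
    by (simp add: VectorSpace.subspace_def matrix_vs)
  then show ?thesis
    by (rule subspace_is_vs)
qed

end

(* The symmetric unitary matrix V has eigenvector columns sin(2 pi j m / n), so the algebra consists of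
   the matrices V diag(d) V^*, with entries (4/n) sum_m d_m sin(2 pi j m / n) sin(2 pi k m / n).
   Everything is read off the eigenvalues d. Since sin(j x) sin(k x) / sin x is a sum of
   sines along an arithmetic progression with step 2, d is determined by the first row of the matrix,
   which gives (1). By orthogonality T_i has eigenvalues 2 cos(2 pi i m / n), and by Lagrange
   interpolation it generates the algebra iff these are distinct; if g = gcd(i, n) > 1, then
   m = 1 and m = n / g - 1 collide. Writing the product of sines as a difference of cosines gives (3). *)

theory Submission
  imports Defs
begin

section \<open>Discrete Fourier sums\<close>

text \<open>N counts the m with 0 < 2 m < n: one representative for each pair of distinct residues m
  and -m modulo n. Sines vanish at the self-paired residues 0 and n/2, so for summands that are even
  in m and contain a sine factor, the sum over 1..N is half the sum over a full period. There
  orthogonality is a matter of divisibility by n, which is why angles are kept as integer multiples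
  of 2 pi / n. The map \<open>dst_conj\<close> from functions on {1..N} to matrices is injective,
  linear and multiplicative, so each claim about the algebra becomes one about functions of m. For
  even n the residue n/2 belongs to none of X_1, ..., X_N, and this is where (3) uses that n is odd.
  For n = 4, for instance, N = 1 and T_1 = 0.\<close>

definition ccos :: "nat \<Rightarrow> int \<Rightarrow> real" where
  "ccos n a = cos (2 * pi * of_int a / of_nat n)"

definition csin :: "nat \<Rightarrow> int \<Rightarrow> real" where
  "csin n a = sin (2 * pi * of_int a / of_nat n)"

lemma ccos_0 [simp]: "ccos n 0 = 1" and csin_0 [simp]: "csin n 0 = 0"
  by (simp_all add: ccos_def csin_def)

lemma ccos_minus [simp]: "ccos n (- a) = ccos n a" and csin_minus [simp]: "csin n (- a) = - csin n a"
  by (simp_all add: ccos_def csin_def)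

lemma ccos_add: "ccos n (a + b) = ccos n a * ccos n b - csin n a * csin n b"
  and csin_add: "csin n (a + b) = csin n a * ccos n b + ccos n a * csin n b"
  by (simp_all add: ccos_def csin_def ring_distribs add_divide_distrib cos_add sin_add)

lemma ccos_diff: "ccos n (a - b) = ccos n a * ccos n b + csin n a * csin n b"
  and csin_diff: "csin n (a - b) = csin n a * ccos n b - ccos n a * csin n b"
  using ccos_add[of n a "- b"] csin_add[of n a "- b"] by simp_all

lemma csin_times_csin: "csin n a * csin n b = (ccos n (a - b) - ccos n (a + b)) / 2"
  by (simp add: ccos_diff ccos_add)

lemma
  assumes "n > 0"
  shows ccos_mult_n [simp]: "ccos n (int n * k) = 1" and csin_mult_n [simp]: "csin n (int n * k) = 0"
proof -
  have "2 * pi * of_int (int n * k) / of_nat n = 2 * pi * of_int k"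
    using assms by simp
  then show "ccos n (int n * k) = 1" "csin n (int n * k) = 0"
    by (simp_all only: ccos_def csin_def cos_int_2pin sin_int_2pin)
qed

text \<open>The residue n/2 has angle pi, all of whose integer multiples are zeros of the sine.
  Hence the midpoint of the period drops out of sine sums.\<close>

lemma csin_eq_0_half:
  assumes "n > 0" "2 * a = int n"
  shows "csin n (a * m) = 0"
proof -
  have n_eq: "real n = 2 * of_int a"
    using assms(2) by linarith
  have "2 * pi * of_int (a * m) / real n = pi * of_int m"
    using assms unfolding n_eq by simp
  then show ?thesis
    by (simp only: csin_def sin_npi_int)
qed

lemma csin_pos:
  assumes "0 < a" "2 * a < int n"
  shows "csin n a > 0"
proof -
  have "real_of_int (2 * a) < real n"
    using assms(2) by linarith
  then have "pi * real_of_int (2 * a) < pi * real n"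
    by (intro mult_strict_left_mono) auto
  then show ?thesis
    unfolding csin_def using assms by (intro sin_gt_zero) (auto simp: field_simps)
qed

text \<open>A difference of cosines is twice a product of two sines at half the sum and half the
  difference of the angles; each factor vanishes exactly at the multiples of n.\<close>

lemma ccos_eq_iff:
  assumes n: "n > 0"
  shows "ccos n a = ccos n b \<longleftrightarrow> int n dvd a - b \<or> int n dvd a + b"
proof -
  have sin0: "sin (pi * of_int c / real n) = 0 \<longleftrightarrow> int n dvd c" for c
  proof -
    have "sin (pi * of_int c / real n) = 0 \<longleftrightarrow> (\<exists>k. real_of_int c = real_of_int (int n * k))"
      using n by (auto simp: sin_zero_iff_int2 field_simps)
    then show ?thesis
      by (simp only: of_int_eq_iff dvd_def)
  qed
  have "ccos n a - ccos n b =
    2 * sin (pi * of_int (a + b) / real n) * sin (pi * of_int (b - a) / real n)"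
  proof -
    have "(2 * pi * of_int a / real n + 2 * pi * of_int b / real n) / 2 = pi * of_int (a + b) / real n"
      "(2 * pi * of_int b / real n - 2 * pi * of_int a / real n) / 2 = pi * of_int (b - a) / real n"
      using n by (simp_all add: field_simps)
    then show ?thesis
      by (simp only: ccos_def cos_diff_cos)
  qed
  then have "ccos n a = ccos n b \<longleftrightarrow> int n dvd a + b \<or> int n dvd b - a"
    unfolding sin0[symmetric] by auto
  then show ?thesis
    by (auto simp: dvd_diff_commute)
qed

text \<open>Real part of the geometric sum over the powers of an n-th root of unity, which is 0
  unless the root is 1.\<close>

lemma sum_ccos_period:
  assumes n: "n > 0"
  shows "(\<Sum>m<n. ccos n (a * int m)) = (if int n dvd a then real n else 0)"
proof -
  define z where "z = cis (2 * pi * of_int a / of_nat n)"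
  have z_pow: "z ^ m = Complex (ccos n (a * int m)) (csin n (a * int m))" for m
  proof -
    have "real m * (2 * pi * of_int a / real n) = 2 * pi * of_int (a * int m) / real n"
      by simp
    then show ?thesis
      unfolding z_def DeMoivre by (simp only: ccos_def csin_def cis.code)
  qed
  have "z ^ n = 1"
    using n by (simp add: z_pow mult.commute[of a] one_complex.code)
  then have "(\<Sum>m<n. z ^ m) = (if z = 1 then of_nat n else 0)"
    by (simp add: sum_gp_strict)
  moreover have "z = 1 \<longleftrightarrow> int n dvd a"
  proof
    assume "z = 1"
    then have "ccos n a = ccos n 0"
      using arg_cong[OF z_pow[of 1], of Re] by simp
    then show "int n dvd a"
      using n by (simp only: ccos_eq_iff) simp
  next
    assume "int n dvd a"
    then show "z = 1"
      using z_pow[of 1] n by (auto simp: complex_eq_iff)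
  qed
  ultimately have "Re (\<Sum>m<n. z ^ m) = (if int n dvd a then real n else 0)"
    by simp
  then show ?thesis
    by (simp add: z_pow)
qed

text \<open>The offset 1/4 pushes n/2 below an integer when n is even and leaves the floor unchanged
  when n is odd.\<close>

lemma dst_dim_eq: "n > 0 \<Longrightarrow> dst_dim n = (n - 1) div 2"
proof -
  assume "n > 0"
  then have "\<lfloor>(real n - 1 / 4) / 2\<rfloor> = int ((n - 1) div 2)"
    by (cases "even n") (auto intro!: floor_unique elim!: evenE oddE simp: field_simps of_nat_diff)
  then show ?thesis
    by (simp add: dst_dim_def)
qed

text \<open>Halves a sum over a period: the summand is invariant under \<open>m \<mapsto> n - m\<close>, and the fixed
  points 0 and \<open>n / 2\<close> contribute nothing.\<close>

lemma sum_dst_dim: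
  fixes f :: "nat \<Rightarrow> real"
  assumes n: "n > 0" and f0: "f 0 = 0" and sym: "\<And>m. 0 < m \<Longrightarrow> m < n \<Longrightarrow> f (n - m) = f m"
    and half: "\<And>m. 2 * m = n \<Longrightarrow> f m = 0"
  shows "(\<Sum>m<n. f m) = 2 * (\<Sum>m = 1..dst_dim n. f m)"
proof -
  let ?N = "dst_dim n"
  define C where "C = {m. m < n \<and> (m = 0 \<or> 2 * m = n)}"
  have N: "m \<le> ?N \<longleftrightarrow> 2 * m < n" for m
    using n by (simp add: dst_dim_eq) linarith
  have "{..<n} = C \<union> ({1..?N} \<union> (\<lambda>m. n - m) ` {1..?N})"
  proof -
    have "m \<in> (\<lambda>m. n - m) ` {1..?N}" if "m < n" "n < 2 * m" for m
      using that by (intro image_eqI[of _ _ "n - m"]) (auto simp: N)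
    then show ?thesis
      using n by (force simp: C_def N)
  qed
  moreover have "C \<inter> ({1..?N} \<union> (\<lambda>m. n - m) ` {1..?N}) = {}" "{1..?N} \<inter> (\<lambda>m. n - m) ` {1..?N} = {}"
  proof -
    have low: "0 < m \<and> 2 * m < n" if "m \<in> {1..?N}" for m
      using that N[of m] by simp
    have high: "n < 2 * m \<and> m < n" if m: "m \<in> (\<lambda>m. n - m) ` {1..?N}" for m
    proof -
      obtain k where "k \<in> {1..?N}" "m = n - k"
        using m by blast
      then show ?thesis
        using low[of k] by linarith
    qed
    have C: "m = 0 \<or> 2 * m = n" if "m \<in> C" for m
      using that by (simp add: C_def)
    show "C \<inter> ({1..?N} \<union> (\<lambda>m. n - m) ` {1..?N}) = {}"
    proof (rule equals0I)
      fix m assume "m \<in> C \<inter> ({1..?N} \<union> (\<lambda>m. n - m) ` {1..?N})"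
      then show False
        using low[of m] high[of m] C[of m] by (elim IntE UnE) linarith+
    qed
    show "{1..?N} \<inter> (\<lambda>m. n - m) ` {1..?N} = {}"
    proof (rule equals0I)
      fix m assume "m \<in> {1..?N} \<inter> (\<lambda>m. n - m) ` {1..?N}"
      then show False
        using low[of m] high[of m] by (elim IntE) linarith
    qed
  qed
  moreover have "finite C"
    by (simp add: C_def)
  ultimately have "(\<Sum>m<n. f m) = sum f C + (sum f {1..?N} + sum f ((\<lambda>m. n - m) ` {1..?N}))"
    by (simp add: sum.union_disjoint)
  also have "sum f C = 0"
    using f0 half by (intro sum.neutral) (auto simp: C_def)
  also have "sum f ((\<lambda>m. n - m) ` {1..?N}) = (\<Sum>m = 1..?N. f (n - m))"
    by (subst sum.reindex) (auto simp: inj_on_def N)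
  also have "\<dots> = sum f {1..?N}"
    by (intro sum.cong) (auto simp: N intro!: sym)
  finally show ?thesis
    by simp
qed

text \<open>Under m -> n - m both sines change sign and the cosine does not, so the sum is half a
  sum over a period. The product is a quarter of a signed sum of four cosines, whence n/8. The case
  a = 0 gives orthogonality, general a the entries of T_a.\<close>

lemma sum_ccos_csin_csin:
  assumes n: "n > 0"
  shows "(\<Sum>m = 1..dst_dim n. ccos n (a * int m) * csin n (b * int m) * csin n (c * int m)) =
    real n / 8 * (of_bool (int n dvd a + b - c) + of_bool (int n dvd a - b + c)
      - of_bool (int n dvd a + b + c) - of_bool (int n dvd a - b - c))"
    (is "sum ?f _ = _")
proof -
  have "?f (n - m) = ?f m" if "m < n" for m
  proof -
    have "x * int (n - m) = int n * x - x * int m" for x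
      using that by (simp add: of_nat_diff algebra_simps)
    then show ?thesis
      using n by (simp add: ccos_diff csin_diff)
  qed
  moreover have "?f m = 0" if "2 * m = n" for m
    using that csin_eq_0_half[OF n, of "int m" b] by (simp add: mult.commute)
  ultimately have "2 * sum ?f {1..dst_dim n} = (\<Sum>m<n. ?f m)"
    by (subst sum_dst_dim[OF n]) auto
  also have "\<dots> = (\<Sum>m<n. (ccos n ((a + b - c) * int m) + ccos n ((a - b + c) * int m)
      - ccos n ((a + b + c) * int m) - ccos n ((a - b - c) * int m)) / 4)"
    by (intro sum.cong refl) (simp add: ring_distribs ccos_add ccos_diff csin_add csin_diff)
  also have "\<dots> = real n / 4 * (of_bool (int n dvd a + b - c) + of_bool (int n dvd a - b + c)
      - of_bool (int n dvd a + b + c) - of_bool (int n dvd a - b - c))"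
    unfolding sum_divide_distrib[symmetric] sum_subtractf sum.distrib sum_ccos_period[OF n]
    by simp
  finally show ?thesis
    by simp
qed

section \<open>The algebra in terms of eigenvalues\<close>

lemma mat1_carrier [simp]: "mat1 N f \<in> carrier_mat N N"
  and dim_row_mat1 [simp]: "dim_row (mat1 N f) = N"
  and dim_col_mat1 [simp]: "dim_col (mat1 N f) = N"
  and index_mat1 [simp]: "j < N \<Longrightarrow> k < N \<Longrightarrow> mat1 N f $$ (j, k) = f (Suc j) (Suc k)"
  by (simp_all add: mat1_def)

lemma mat1_eq_iff: "mat1 N f = mat1 N g \<longleftrightarrow> (\<forall>j\<in>{1..N}. \<forall>k\<in>{1..N}. f j k = g j k)"
proof
  assume eq: "mat1 N f = mat1 N g"
  have "f j k = g j k" if "j \<in> {1..N}" "k \<in> {1..N}" for j k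
    using arg_cong[OF eq, of "\<lambda>A. A $$ (j - 1, k - 1)"] that by (cases j; cases k) auto
  then show "\<forall>j\<in>{1..N}. \<forall>k\<in>{1..N}. f j k = g j k"
    by blast
next
  assume "\<forall>j\<in>{1..N}. \<forall>k\<in>{1..N}. f j k = g j k"
  then show "mat1 N f = mat1 N g"
    by (intro eq_matI) auto
qed

lemma mat1_eqI:
  assumes "\<And>j k. 1 \<le> j \<Longrightarrow> j \<le> N \<Longrightarrow> 1 \<le> k \<Longrightarrow> k \<le> N \<Longrightarrow> f j k = g j k"
  shows "mat1 N f = mat1 N g"
  using assms by (simp add: mat1_eq_iff)

lemma mat1_times: "mat1 N f * mat1 N g = mat1 N (\<lambda>j k. \<Sum>m = 1..N. f j m * g m k)"
  by (intro eq_matI)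
    (simp_all add: scalar_prod_def sum.atLeast1_atMost_eq lessThan_atLeast0)

lemma mat_diag_eq_mat1: "mat_diag N g = mat1 N (\<lambda>j k. if j = k then g (j - 1) else 0)"
  by (intro eq_matI) (simp_all add: mat_diag_def)

lemma one_mat_eq_mat1: "1\<^sub>m N = mat1 N (\<lambda>j k. of_bool (j = k))"
  by (intro eq_matI) simp_all

lemma mat_adjoint_mat1: "mat_adjoint (mat1 N f) = mat1 N (\<lambda>j k. cnj (f k j))"
  by (intro eq_matI) (simp_all add: mat_adjoint_def mat_of_rows_def)

lemma dst_mat_eq: "dst_mat n = mat1 (dst_dim n) (\<lambda>j k.
    2 / (\<i> * of_real (sqrt (real n))) * of_real (csin n (int j * int k)))"
  by (simp add: dst_mat_def csin_def mult_ac)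

lemma mat_adjoint_dst_mat: "mat_adjoint (dst_mat n) = mat1 (dst_dim n) (\<lambda>j k.
    - 2 / (\<i> * of_real (sqrt (real n))) * of_real (csin n (int j * int k)))"
  unfolding dst_mat_eq mat_adjoint_mat1 by (intro mat1_eqI) (simp add: mult.commute)

text \<open>This is V diag(d 1, ..., d N) times the adjoint of V, multiplied out; 4/n is the squared
  modulus of the scale factor of V.\<close>

definition dst_conj :: "nat \<Rightarrow> (nat \<Rightarrow> complex) \<Rightarrow> complex mat" where
  "dst_conj n d = mat1 (dst_dim n) (\<lambda>j k. \<Sum>m = 1..dst_dim n.
     of_real (4 / real n) * d m * of_real (csin n (int j * int m) * csin n (int k * int m)))"

lemma dst_conj_cong:
  "(\<And>m. m \<in> {1..dst_dim n} \<Longrightarrow> d m = e m) \<Longrightarrow> dst_conj n d = dst_conj n e"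
  by (simp add: dst_conj_def)

lemma dst_conj_carrier [simp]: "dst_conj n d \<in> carrier_mat (dst_dim n) (dst_dim n)"
  by (simp add: dst_conj_def)

lemma dst_mat_carrier [simp]: "dst_mat n \<in> carrier_mat (dst_dim n) (dst_dim n)"
  "mat_adjoint (dst_mat n) \<in> carrier_mat (dst_dim n) (dst_dim n)"
  unfolding mat_adjoint_dst_mat by (simp_all add: dst_mat_eq)

lemma not_int_dvd_less: "0 < a \<Longrightarrow> a < int n \<Longrightarrow> \<not> int n dvd a"
  using zdvd_not_zless by blast

context
  fixes n :: nat
  assumes n: "n > 0"
begin

lemma le_dst_dim_iff: "m \<le> dst_dim n \<longleftrightarrow> 2 * m < n"
  using n by (simp add: dst_dim_eq) linarith

lemma int_dvd_diff_iff:
  assumes "j \<le> dst_dim n" "k \<le> dst_dim n"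
  shows "int n dvd int j - int k \<longleftrightarrow> j = k"
proof -
  have "\<bar>int j - int k\<bar> < int n"
    using assms by (simp add: le_dst_dim_iff)
  then show ?thesis
    using not_int_dvd_less[of "\<bar>int j - int k\<bar>" n] by auto
qed

lemma not_int_dvd_add:
  assumes "1 \<le> j" "j \<le> dst_dim n" "k \<le> dst_dim n"
  shows "\<not> int n dvd int j + int k"
  using assms by (intro not_int_dvd_less) (simp_all add: le_dst_dim_iff)

text \<open>The case a = 0 of \<open>sum_ccos_csin_csin\<close>: within 1..N two of the
  divisibilities mean j = k and the other two never hold.\<close>

lemma sum_csin_csin:
  assumes "1 \<le> j" "j \<le> dst_dim n" "k \<le> dst_dim n"
  shows "(\<Sum>m = 1..dst_dim n. csin n (int j * int m) * csin n (int k * int m)) =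
    real n / 4 * of_bool (j = k)"
proof -
  have "int n dvd int k - int j \<longleftrightarrow> j = k" "\<not> int n dvd - int j - int k"
    using int_dvd_diff_iff[of k j] not_int_dvd_add[of j k] assms
    by (auto simp flip: dvd_minus_iff[of _ "int j + int k"])
  then show ?thesis
    using sum_ccos_csin_csin[OF n, of 0 "int j" "int k"] int_dvd_diff_iff[of j k]
      not_int_dvd_add[of j k] assms by simp
qed

text \<open>V is real up to the factor 1/i, so conjugation only negates its scale factor. The shape
  is that of the summands in a product of V with its adjoint.\<close>

lemma dst_mat_scale:
  "2 / (\<i> * of_real (sqrt (real n))) * x * (- 2 / (\<i> * of_real (sqrt (real n))) * y) =
    of_real (4 / real n) * (x * y :: complex)"
proof -
  have "complex_of_real (sqrt (real n)) * complex_of_real (sqrt (real n)) = of_nat n"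
    by (simp flip: of_real_mult)
  then show ?thesis
    by (simp add: field_simps)
qed

lemma dst_mat_unitary:
  "dst_mat n * mat_adjoint (dst_mat n) = 1\<^sub>m (dst_dim n)"
  "mat_adjoint (dst_mat n) * dst_mat n = 1\<^sub>m (dst_dim n)"
proof -
  have "(\<Sum>m = 1..dst_dim n. of_real (4 / real n) *
      (complex_of_real (csin n (int j * int m)) * of_real (csin n (int m * int k)))) =
      of_bool (j = k)" if "1 \<le> j" "j \<le> dst_dim n" "k \<le> dst_dim n" for j k
  proof -
    have "(\<Sum>m = 1..dst_dim n. of_real (4 / real n) *
        (complex_of_real (csin n (int j * int m)) * of_real (csin n (int m * int k)))) =
      of_real (4 / real n * (\<Sum>m = 1..dst_dim n. csin n (int j * int m) * csin n (int k * int m)))"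
      unfolding sum_distrib_left of_real_sum of_real_mult mult.commute[of _ "int k"] ..
    then show ?thesis
      using n by (simp only: sum_csin_csin[OF that]) simp
  qed
  then show "dst_mat n * mat_adjoint (dst_mat n) = 1\<^sub>m (dst_dim n)"
    unfolding mat_adjoint_dst_mat unfolding dst_mat_eq mat1_times one_mat_eq_mat1 dst_mat_scale
    by (intro mat1_eqI)
  then show "mat_adjoint (dst_mat n) * dst_mat n = 1\<^sub>m (dst_dim n)"
    by (rule mat_mult_left_right_inverse[rotated 2]) simp_all
qed

lemma dst_conj_eq:
  "dst_mat n * mat_diag (dst_dim n) (\<lambda>m. d (Suc m)) * mat_adjoint (dst_mat n) = dst_conj n d"
proof -
  have "dst_mat n * mat_diag (dst_dim n) (\<lambda>m. d (Suc m)) = mat1 (dst_dim n) (\<lambda>j k.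
      2 / (\<i> * of_real (sqrt (real n))) * (d k * of_real (csin n (int j * int k))))"
    unfolding mat_diag_eq_mat1 dst_mat_eq mat1_times
    by (intro mat1_eqI) (simp add: if_distrib[of "\<lambda>x. x * _"] if_distrib[of "\<lambda>x. _ * x"]
      if_distrib[of "\<lambda>x. x / _"] mult_ac cong: if_cong)
  then show ?thesis
    unfolding mat_adjoint_dst_mat dst_conj_def
    by (simp only: mat1_times dst_mat_scale) (simp add: mult_ac)
qed

lemma adjoint_dst_conj:
  "mat_adjoint (dst_mat n) * dst_conj n d * dst_mat n = mat_diag (dst_dim n) (\<lambda>m. d (Suc m))"
proof -
  let ?N = "dst_dim n" and ?V = "dst_mat n" and ?U = "mat_adjoint (dst_mat n)"
  let ?D = "mat_diag ?N (\<lambda>m. d (Suc m))"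
  have "?U * (?V * ?D * ?U) * ?V = (?U * ?V) * ?D * (?U * ?V)"
    by (simp add: assoc_mult_mat[of _ ?N ?N _ ?N _ ?N] mult_carrier_mat[of _ ?N ?N _ ?N])
  also have "\<dots> = ?D"
    by (simp add: dst_mat_unitary left_mult_one_mat[OF mat_diag_dim] right_mult_one_mat[OF mat_diag_dim])
  finally show ?thesis
    by (simp add: dst_conj_eq)
qed

text \<open>Conjugating back with V recovers the eigenvalues; from here on matrix equations are
  equations between functions on 1..N.\<close>

lemma dst_conj_eq_iff: "dst_conj n d = dst_conj n e \<longleftrightarrow> (\<forall>m\<in>{1..dst_dim n}. d m = e m)"
proof
  assume "dst_conj n d = dst_conj n e"
  then have eq: "mat_diag (dst_dim n) (\<lambda>m. d (Suc m)) = mat_diag (dst_dim n) (\<lambda>m. e (Suc m))"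
    by (metis adjoint_dst_conj)
  have "d m = e m" if "m \<in> {1..dst_dim n}" for m
    using arg_cong[OF eq, of "\<lambda>A. A $$ (m - 1, m - 1)"] that
    by (cases m) (auto simp: mat_diag_def)
  then show "\<forall>m\<in>{1..dst_dim n}. d m = e m"
    by blast
qed (auto intro: dst_conj_cong)

text \<open>By unitarity S is recovered from the diagonal matrix \<open>?U * S * ?V\<close>, whose
  diagonal supplies the eigenvalues.\<close>

lemma dst_algebra_eq: "dst_algebra n = range (dst_conj n)"
proof (intro equalityI subsetI)
  let ?N = "dst_dim n" and ?V = "dst_mat n" and ?U = "mat_adjoint (dst_mat n)"
  fix S assume S: "S \<in> dst_algebra n"
  then have S_carrier [simp]: "S \<in> carrier_mat ?N ?N"
    by (simp add: dst_algebra_def)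
  let ?D = "?U * S * ?V"
  have "S = (?V * ?U) * S * (?V * ?U)"
    by (simp add: dst_mat_unitary left_mult_one_mat[OF S_carrier] right_mult_one_mat[OF S_carrier])
  also have "\<dots> = ?V * ?D * ?U"
    by (simp add: assoc_mult_mat[of _ ?N ?N _ ?N _ ?N] mult_carrier_mat[of _ ?N ?N _ ?N])
  \<comment> \<open>The index \<open>Suc m - 1\<close> is left unsimplified to match the pattern
    \<open>d (Suc m)\<close> of \<open>dst_conj_eq\<close>.\<close>
  also have "?D = mat_diag ?N (\<lambda>m. ?D $$ (Suc m - 1, Suc m - 1))"
  proof -
    have dims: "dim_row ?D = ?N" "dim_col ?D = ?N"
      by (simp_all add: carrier_matD[OF dst_mat_carrier(1)] carrier_matD[OF dst_mat_carrier(2)]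
        del: dst_mat_carrier)
    moreover have "diagonal_mat ?D"
      using S by (simp add: dst_algebra_def)
    ultimately show ?thesis
      unfolding diagonal_mat_def by (intro eq_matI) (simp_all add: mat_diag_def)
  qed
  finally have "S = dst_conj n (\<lambda>m. ?D $$ (m - 1, m - 1))"
    using dst_conj_eq[of "\<lambda>m. ?D $$ (m - 1, m - 1)"] by (rule trans)
  then show "S \<in> range (dst_conj n)"
    by blast
next
  fix S assume "S \<in> range (dst_conj n)"
  then show "S \<in> dst_algebra n"
    by (auto simp: dst_algebra_def adjoint_dst_conj) (simp add: diagonal_mat_def mat_diag_def)
qed

lemma dst_conj_one: "dst_conj n (\<lambda>_. 1) = 1\<^sub>m (dst_dim n)"
  using dst_conj_eq[of "\<lambda>_. 1"] right_mult_one_mat[OF dst_mat_carrier(1)[of n]]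
  by (simp add: dst_mat_unitary)

text \<open>The adjoint of V cancels against V in the middle. Multiplication is thus pointwise on
  eigenvalues, and polynomials in a matrix become polynomials in its eigenvalues.\<close>

lemma dst_conj_times: "dst_conj n d * dst_conj n e = dst_conj n (\<lambda>m. d m * e m)"
proof -
  let ?N = "dst_dim n" and ?V = "dst_mat n" and ?U = "mat_adjoint (dst_mat n)"
  let ?D = "\<lambda>d. mat_diag ?N (\<lambda>m. d (Suc m))"
  have "dst_conj n d * dst_conj n e = ?V * ?D d * (?U * ?V) * ?D e * ?U"
    unfolding dst_conj_eq[symmetric]
    by (simp add: assoc_mult_mat[of _ ?N ?N _ ?N _ ?N] mult_carrier_mat[of _ ?N ?N _ ?N])
  also have "\<dots> = ?V * (?D d * ?D e) * ?U"
    by (simp only: dst_mat_unitary right_mult_one_mat[OF mult_carrier_mat[OF dst_mat_carrier(1) mat_diag_dim]]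
      assoc_mult_mat[OF dst_mat_carrier(1) mat_diag_dim mat_diag_dim])
  finally show ?thesis
    by (simp add: dst_conj_eq[of "\<lambda>m. d m * e m"])
qed

lemma dst_conj_power: "dst_conj n d ^\<^sub>m p = dst_conj n (\<lambda>m. d m ^ p)"
  by (induction p) (simp_all add: dst_conj_one dst_conj_times carrier_matD[OF dst_conj_carrier] mult.commute)

end

section \<open>Bases and generated subalgebras\<close>

text \<open>Both \<open>lincomb\<close> and the polynomials in \<open>generated_algebra\<close> are
  \<open>finsum\<close>s over module records; entrywise they are ordinary sums. Assuming only an
  inclusion of carriers also covers the record restricted to \<open>dst_algebra n\<close>.\<close>

lemma finsum_mat_index:
  assumes "abelian_monoid M" and M: "carrier M \<subseteq> carrier_mat nr nc"
    "add M = (+)" "zero M = (0\<^sub>m nr nc :: 'a :: comm_monoid_add mat)"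
    and A: "finite A" "f \<in> A \<rightarrow> carrier M" and jk: "j < nr" "k < nc"
  shows "finsum M f A $$ (j, k) = (\<Sum>a\<in>A. f a $$ (j, k))"
proof -
  interpret abelian_monoid M by fact
  show ?thesis
    using A
  proof (induction rule: finite_induct)
    case (insert a A)
    then have "finsum M f A \<in> carrier_mat nr nc"
      using M(1) finsum_closed[of f A] by auto
    then show ?case
      using insert jk by (simp add: M(2))
  qed (use jk in \<open>simp add: M(3)\<close>)
qed

text \<open>Newton interpolation: a new node is served by adding a multiple of \<open>q\<close>,
  which vanishes at the old nodes.\<close>

lemma ex_poly_interpolation:
  fixes f g :: "'b \<Rightarrow> 'a :: field"
  assumes "finite A" "inj_on f A"
  shows "\<exists>p. \<forall>a\<in>A. poly p (f a) = g a"
  using assms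
proof (induction rule: finite_induct)
  case (insert a A)
  then obtain p where p: "\<forall>b\<in>A. poly p (f b) = g b"
    by auto
  define q where "q = (\<Prod>b\<in>A. [:- f b, 1:])"
  have "poly q (f a) \<noteq> 0"
    using insert by (auto simp: q_def poly_prod)
  moreover have "poly q (f b) = 0" if "b \<in> A" for b
    using insert that by (auto simp: q_def poly_prod)
  ultimately have "\<forall>b\<in>insert a A.
      poly (p + smult ((g a - poly p (f a)) / poly q (f a)) q) (f b) = g b"
    using p by simp
  then show ?case ..
qed simp

lemma dst_conj_sum_index:
  assumes "j < dst_dim n" "k < dst_dim n"
  shows "dst_conj n (\<lambda>m. \<Sum>i\<in>A. c i * e i m) $$ (j, k) = (\<Sum>i\<in>A. c i * dst_conj n (e i) $$ (j, k))"
  using assms unfolding dst_conj_def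
  by (simp only: index_mat1 sum_distrib_left sum_distrib_right, subst sum.swap,
    intro sum.cong refl) (simp only: mult_ac)

context
  fixes n :: nat
  assumes n: "n > 0"
begin

text \<open>Moves the basis property from matrices to eigenvalue functions. \<open>basis\<close>
  concerns a set, with coefficients indexed by matrices; injectivity of \<open>F\<close>, itself a
  consequence of independence, translates them to coefficients indexed by i.\<close>

lemma dst_algebra_basisI:
  assumes F: "\<And>i. i \<in> {1..dst_dim n} \<Longrightarrow> F i = dst_conj n (e i)"
    and indep: "\<And>c. (\<And>m. m \<in> {1..dst_dim n} \<Longrightarrow> (\<Sum>i = 1..dst_dim n. c i * e i m) = 0) \<Longrightarrow>
      \<forall>i\<in>{1..dst_dim n}. c i = 0"
    and span: "\<And>d. \<exists>c. \<forall>m\<in>{1..dst_dim n}. d m = (\<Sum>i = 1..dst_dim n. c i * e i m)"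
  shows "dst_algebra_basis n F"
proof -
  let ?N = "dst_dim n" and ?I = "{1..dst_dim n}"
  let ?M = "module_mat TYPE(complex) ?N ?N\<lparr>carrier := dst_algebra n\<rparr>"
  interpret vectorspace class_ring ?M
    by (rule dst_algebra_vectorspace)
  have inj: "inj_on F ?I"
  proof (rule inj_onI, rule ccontr)
    fix a b assume ab: "a \<in> ?I" "b \<in> ?I" "F a = F b" "a \<noteq> b"
    \<comment> \<open>If F a = F b, this is a nontrivial relation among the eigenvalue
      functions.\<close>
    define c :: "nat \<Rightarrow> complex" where "c i = of_bool (i = a) - of_bool (i = b)" for i
    have "(\<Sum>i = 1..?N. c i * e i m) = e a m - e b m" if "m \<in> ?I" for m
      using ab by (simp add: c_def ring_distribs sum_subtractf of_bool_def if_distrib[of "\<lambda>x. x * _"] cong: if_cong)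
    moreover have "e a m = e b m" if "m \<in> ?I" for m
      using ab that F by (metis dst_conj_eq_iff[OF n])
    ultimately have "\<forall>i\<in>?I. c i = 0"
      by (intro indep) simp
    then have "c a = 0"
      using ab by blast
    then show False
      using ab by (simp add: c_def)
  qed
  have F_mem: "F ` ?I \<subseteq> carrier ?M"
    using F by (auto simp: dst_algebra_eq[OF n])
  have lincomb: "lincomb c (F ` ?I) = dst_conj n (\<lambda>m. \<Sum>i = 1..?N. c (F i) * e i m)" for c
  proof -
    have smult: "(\<lambda>v. c v \<odot>\<^bsub>?M\<^esub> v) \<in> F ` ?I \<rightarrow> carrier ?M"
      using F_mem by (intro Pi_I smult_closed) (auto simp: class_ring_simps)
    have alg: "dst_algebra n \<subseteq> carrier_mat ?N ?N"
      by (auto simp: dst_algebra_def)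
    have "lincomb c (F ` ?I) \<in> carrier ?M"
      using F_mem by (intro lincomb_closed) (simp_all add: class_ring_simps)
    then have carr: "lincomb c (F ` ?I) \<in> carrier_mat ?N ?N"
      using alg by auto
    have "lincomb c (F ` ?I) $$ (j, k) = (\<Sum>i = 1..?N. c (F i) * dst_conj n (e i) $$ (j, k))"
      if "j < ?N" "k < ?N" for j k
    proof -
      have "lincomb c (F ` ?I) $$ (j, k) = (\<Sum>v\<in>F ` ?I. (c v \<odot>\<^bsub>?M\<^esub> v) $$ (j, k))"
        unfolding lincomb_def using alg
        by (intro finsum_mat_index[OF _ _ _ _ _ smult that])
          (simp_all add: module_mat_simps abelian_monoid_axioms)
      also have "\<dots> = (\<Sum>i = 1..?N. (c (F i) \<cdot>\<^sub>m F i) $$ (j, k))"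
        using inj by (simp add: sum.reindex module_mat_simps)
      finally show ?thesis
        using that F by (simp add: carrier_matD[OF dst_conj_carrier])
    qed
    then show ?thesis
      using carr by (intro eq_matI) (simp_all add: dst_conj_sum_index carrier_matD[OF dst_conj_carrier])
  qed
  have zero: "\<zero>\<^bsub>?M\<^esub> = dst_conj n (\<lambda>_. 0)"
    by (intro eq_matI) (simp_all add: dst_conj_def module_mat_simps)
  have "lin_indpt (F ` ?I)"
  proof (rule finite_lin_indpt2)
    fix c assume "lincomb c (F ` ?I) = \<zero>\<^bsub>?M\<^esub>"
    then have "\<forall>i\<in>?I. c (F i) = 0"
      by (intro indep) (simp only: lincomb zero dst_conj_eq_iff[OF n])
    then show "\<forall>v\<in>F ` ?I. c v = \<zero>\<^bsub>class_ring\<^esub>"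
      by (simp add: class_ring_simps)
  qed (use F_mem in auto)
  moreover have "carrier ?M \<subseteq> span (F ` ?I)"
  proof
    fix S assume "S \<in> carrier ?M"
    then obtain d where S: "S = dst_conj n d"
      by (auto simp: dst_algebra_eq[OF n])
    obtain c where c: "\<forall>m\<in>?I. d m = (\<Sum>i = 1..?N. c i * e i m)"
      using span by blast
    have "S = lincomb (c \<circ> inv_into ?I F) (F ` ?I)"
      unfolding S lincomb dst_conj_eq_iff[OF n] using c inj by simp
    then show "S \<in> span (F ` ?I)"
      using F_mem by (subst finite_span) (auto simp: class_ring_simps)
  qed
  ultimately show ?thesis
    using inj F_mem span_closed by (auto simp: dst_algebra_basis_def basis_def)
qed

lemma generated_algebra_dst_conj:
  "generated_algebra (dst_dim n) (dst_conj n d) = (\<lambda>p. dst_conj n (\<lambda>m. poly p (d m))) ` UNIV"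
proof -
  let ?N = "dst_dim n"
  let ?M = "module_mat TYPE(complex) ?N ?N"
  interpret abelian_group ?M
    by (rule abelian_group_mat)
  have "(\<Oplus>\<^bsub>?M\<^esub> i \<in> {..Polynomial.degree p}. Polynomial.coeff p i \<cdot>\<^sub>m (dst_conj n d ^\<^sub>m i)) =
    dst_conj n (\<lambda>m. poly p (d m))" (is "finsum ?M ?f ?A = _") for p
  proof -
    have f: "?f \<in> ?A \<rightarrow> carrier ?M"
      by (simp add: module_mat_simps dst_conj_power[OF n])
    then have "finsum ?M ?f ?A \<in> carrier_mat ?N ?N"
      using finsum_closed[OF f] by (simp add: module_mat_simps)
    moreover have "finsum ?M ?f ?A $$ (j, k) = dst_conj n (\<lambda>m. poly p (d m)) $$ (j, k)"
      if "j < ?N" "k < ?N" for j k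
    proof -
      have "finsum ?M ?f ?A $$ (j, k) = (\<Sum>i\<in>?A. ?f i $$ (j, k))"
        by (intro finsum_mat_index[OF _ _ _ _ _ f that])
          (simp_all add: module_mat_simps abelian_monoid_axioms)
      also have "\<dots> = (\<Sum>i\<in>?A. Polynomial.coeff p i * dst_conj n (\<lambda>m. d m ^ i) $$ (j, k))"
        using that by (simp add: dst_conj_power[OF n] carrier_matD[OF dst_conj_carrier])
      finally show ?thesis
        using that by (simp add: poly_altdef dst_conj_sum_index)
    qed
    ultimately show ?thesis
      by (intro eq_matI) (simp_all add: carrier_matD[OF dst_conj_carrier])
  qed
  then show ?thesis
    unfolding generated_algebra_def by auto
qed

text \<open>A polynomial cannot separate two positions with equal \<open>d\<close>, so the matrix
  with eigenvalue 1 at one of them and 0 elsewhere is out of reach; for distinct values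
  interpolation reaches every eigenvalue function.\<close>

lemma generated_algebra_eq_dst_algebra_iff:
  "generated_algebra (dst_dim n) (dst_conj n d) = dst_algebra n \<longleftrightarrow> inj_on d {1..dst_dim n}"
proof
  assume gen: "generated_algebra (dst_dim n) (dst_conj n d) = dst_algebra n"
  show "inj_on d {1..dst_dim n}"
  proof (rule inj_onI)
    fix a b assume ab: "a \<in> {1..dst_dim n}" "b \<in> {1..dst_dim n}" "d a = d b"
    have "dst_conj n (\<lambda>m. of_bool (m = a)) \<in> dst_algebra n"
      by (simp add: dst_algebra_eq[OF n])
    then obtain p where "dst_conj n (\<lambda>m. of_bool (m = a)) = dst_conj n (\<lambda>m. poly p (d m))"
      unfolding gen[symmetric] generated_algebra_dst_conj by blast
    then have "\<forall>m\<in>{1..dst_dim n}. of_bool (m = a) = poly p (d m)"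
      by (simp only: dst_conj_eq_iff[OF n])
    then have "of_bool (a = a) = (of_bool (b = a) :: complex)"
      using ab by metis
    then show "a = b"
      by (simp split: if_splits)
  qed
next
  assume inj: "inj_on d {1..dst_dim n}"
  have "dst_conj n e \<in> generated_algebra (dst_dim n) (dst_conj n d)" for e
  proof -
    obtain p where "\<forall>m\<in>{1..dst_dim n}. poly p (d m) = e m"
      using ex_poly_interpolation[OF _ inj] by blast
    then have "dst_conj n e = dst_conj n (\<lambda>m. poly p (d m))"
      by (intro dst_conj_cong) simp
    then show ?thesis
      unfolding generated_algebra_dst_conj by blast
  qed
  then show "generated_algebra (dst_dim n) (dst_conj n d) = dst_algebra n"
    unfolding dst_algebra_eq[OF n] by (auto simp: generated_algebra_dst_conj)
qed

end

section \<open>First-row parametrization\<close>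

text \<open>Multiplying by the sine of m turns each term into half a difference of cosines at
  neighbouring points of the progression, and the sum telescopes.\<close>

lemma sum_csin_arith_progression:
  "(\<Sum>l = 1..p. csin n ((q + 2 * int l - 1) * m)) * csin n m =
    (ccos n (q * m) - ccos n ((q + 2 * int p) * m)) / 2"
proof (induction p)
  case (Suc p)
  have "(q + 2 * int (Suc p) - 1) * m - m = (q + 2 * int p) * m"
    "(q + 2 * int (Suc p) - 1) * m + m = (q + 2 * int (Suc p)) * m"
    by (simp_all add: algebra_simps)
  then have "csin n ((q + 2 * int (Suc p) - 1) * m) * csin n m =
      (ccos n ((q + 2 * int p) * m) - ccos n ((q + 2 * int (Suc p)) * m)) / 2"
    by (simp only: csin_times_csin)
  moreover have "(\<Sum>l = 1..Suc p. csin n ((q + 2 * int l - 1) * m)) =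
      (\<Sum>l = 1..p. csin n ((q + 2 * int l - 1) * m)) + csin n ((q + 2 * int (Suc p) - 1) * m)"
    by simp
  ultimately show ?case
    using Suc.IH by (simp only: distrib_right diff_divide_distrib)
qed simp

text \<open>The progression runs from |k - j| + 1 to j + k - 1 in steps of 2, exactly the indices in
  \<open>dst_S\<close>. Its telescoped ends |k - j| and j + k are those of the product formula for
  two sines.\<close>

lemma sum_csin_min:
  "(\<Sum>l = 1..min j k. csin n ((\<bar>int k - int j\<bar> + 2 * int l - 1) * m)) * csin n m =
    csin n (int j * m) * csin n (int k * m)"
proof -
  have "\<bar>int k - int j\<bar> + 2 * int (min j k) = int j + int k"
    by linarith
  moreover have "ccos n (\<bar>int k - int j\<bar> * m) = ccos n ((int j - int k) * m)"
    using ccos_minus[of n "(int j - int k) * m"] by (simp add: abs_if algebra_simps)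
  ultimately show ?thesis
    unfolding sum_csin_arith_progression csin_times_csin by (simp add: algebra_simps)
qed

context
  fixes n :: nat
  assumes n: "n > 0"
begin

text \<open>Inversion of the sine transform: the factor after \<open>s i\<close> is 1 for i = b and
  0 otherwise.\<close>

lemma sum_csin_csin_complex:
  assumes "b \<in> {1..dst_dim n}"
  shows "(\<Sum>i = 1..dst_dim n. s i * of_real (4 / real n *
      (\<Sum>m = 1..dst_dim n. csin n (int i * int m) * csin n (int b * int m)))) = (s b :: complex)"
proof -
  have "(\<Sum>i = 1..dst_dim n. s i * of_real (4 / real n *
      (\<Sum>m = 1..dst_dim n. csin n (int i * int m) * csin n (int b * int m)))) =
      (\<Sum>i = 1..dst_dim n. if i = b then s i else 0)"
    using assms n by (intro sum.cong refl, subst sum_csin_csin[OF n]) auto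
  then show ?thesis
    using assms by simp
qed

text \<open>The summands defining \<open>dst_S\<close> are the values of the odd \<open>n\<close>-periodic extension of \<open>s\<close>; the
  right-hand side is its sine expansion.\<close>

lemma dst_S_term:
  assumes a: "1 \<le> a" "a < int n"
  shows "of_real (sgn (real n / 2 - of_int a)) * s (nat (min (int n - a) a)) =
    (\<Sum>i = 1..dst_dim n. s i * of_real (4 / real n *
      (\<Sum>m = 1..dst_dim n. csin n (int i * int m) * csin n (a * int m))) :: complex)"
proof -
  consider "2 * a < int n" | "2 * a = int n" | "2 * a > int n"
    by linarith
  then show ?thesis
  proof cases
    case 1
    then have "real_of_int (2 * a) < real n"
      by linarith
    then have "sgn (real n / 2 - of_int a) = 1" "min (int n - a) a = a"
      using 1 by (simp_all add: sgn_if)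
    moreover have "nat a \<in> {1..dst_dim n}"
      using a 1 by (simp add: le_dst_dim_iff[OF n]) linarith
    ultimately show ?thesis
      using sum_csin_csin_complex[of "nat a" s] a by simp
  next
    \<comment> \<open>Here n is even and the index of \<open>s\<close> is N + 1, outside the
      parameters; the sign factor and the sine expansion both vanish.\<close>
    case 2
    then have "real_of_int (2 * a) = real n"
      by linarith
    then have "sgn (real n / 2 - of_int a) = 0"
      by (simp add: sgn_if)
    then show ?thesis
      by (simp add: csin_eq_0_half[OF n 2])
  next
    \<comment> \<open>Reflecting a to n - a reduces to the first case; the sines change sign, as
      \<open>sgn\<close> does.\<close>
    case 3
    then have "real_of_int (2 * a) > real n"
      by linarith
    then have "sgn (real n / 2 - of_int a) = - 1" "min (int n - a) a = int n - a"
      using 3 by (simp_all add: sgn_if)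
    moreover have "nat (int n - a) \<in> {1..dst_dim n}"
      using a 3 by (simp add: le_dst_dim_iff[OF n]) linarith
    moreover have "csin n (a * int m) = - csin n ((int n - a) * int m)" for m
      using n by (simp add: left_diff_distrib csin_diff)
    ultimately show ?thesis
      using sum_csin_csin_complex[of "nat (int n - a)" s] a
      by (simp add: sum_negf del: of_real_mult)
  qed
qed

lemma csin_nonzero: "m \<in> {1..dst_dim n} \<Longrightarrow> csin n (int m) \<noteq> 0"
  using csin_pos[of "int m" n] by (simp add: le_dst_dim_iff[OF n])

text \<open>Row 1 of \<open>dst_conj n d\<close> is the sine transform of d m sin(2 pi m / n);
  inverting it gives these eigenvalues. For the other rows the sum over l is carried inside the sum
  over m, where \<open>sum_csin_min\<close> evaluates it.\<close>

lemma dst_S_eq: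
  "dst_S n s = dst_conj n (\<lambda>m. \<Sum>i = 1..dst_dim n. s i * of_real (csin n (int i * int m) / csin n (int m)))"
  unfolding dst_S_def dst_conj_def
proof (rule mat1_eqI)
  let ?I = "{1..dst_dim n}"
  fix j k assume jk: "1 \<le> j" "j \<le> dst_dim n" "1 \<le> k" "k \<le> dst_dim n"
  define a where "a l = \<bar>int k - int j\<bar> + 2 * int l - 1" for l
  have "(\<Sum>l = 1..min j k. complex_of_real (sgn (real n / 2 - \<bar>real k - real j\<bar> - 2 * real l + 1)) *
     s (nat (min (int n - \<bar>int k - int j\<bar> - 2 * int l + 1) (\<bar>int k - int j\<bar> + 2 * int l - 1)))) =
    (\<Sum>l = 1..min j k. complex_of_real (sgn (real n / 2 - of_int (a l))) * s (nat (min (int n - a l) (a l))))"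
    by (simp add: a_def algebra_simps)
  also have "\<dots> = (\<Sum>l = 1..min j k. \<Sum>i\<in>?I. s i * of_real (4 / real n *
      (\<Sum>m\<in>?I. csin n (int i * int m) * csin n (a l * int m))))"
  proof (intro sum.cong refl dst_S_term)
    fix l assume "l \<in> {1..min j k}"
    then show "1 \<le> a l" "a l < int n"
      using jk by (auto simp: a_def le_dst_dim_iff[OF n])
  qed
  also have "\<dots> = (\<Sum>i\<in>?I. s i * of_real (4 / real n *
      (\<Sum>m\<in>?I. csin n (int i * int m) * (\<Sum>l = 1..min j k. csin n (a l * int m)))))"
    unfolding sum_distrib_left of_real_sum
    by (subst sum.swap, rule sum.cong[OF refl], rule sum.swap)
  also have "\<dots> = (\<Sum>i\<in>?I. s i * of_real (4 / real n *
      (\<Sum>m\<in>?I. csin n (int i * int m) / csin n (int m) * (csin n (int j * int m) * csin n (int k * int m)))))"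
  proof -
    have "csin n (int i * int m) * (\<Sum>l = 1..min j k. csin n (a l * int m)) =
      csin n (int i * int m) / csin n (int m) * (csin n (int j * int m) * csin n (int k * int m))"
      if "m \<in> ?I" for i m
      unfolding sum_csin_min[symmetric, of n j "int m" k] a_def using csin_nonzero[OF that] by simp
    then show ?thesis
      by (simp only: cong: sum.cong)
  qed
  also have "\<dots> = (\<Sum>m\<in>?I. of_real (4 / real n) *
      (\<Sum>i\<in>?I. s i * of_real (csin n (int i * int m) / csin n (int m))) *
      of_real (csin n (int j * int m) * csin n (int k * int m)))"
    unfolding sum_distrib_left sum_distrib_right of_real_sum
    by (subst sum.swap, intro sum.cong refl) (simp add: mult_ac)
  finally show "(\<Sum>l = 1..min j k. complex_of_real (sgn (real n / 2 - \<bar>real k - real j\<bar> - 2 * real l + 1)) *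
     s (nat (min (int n - \<bar>int k - int j\<bar> - 2 * int l + 1) (\<bar>int k - int j\<bar> + 2 * int l - 1)))) = \<dots>" .
qed

lemma dst_S_delta:
  assumes "i \<in> {1..dst_dim n}"
  shows "dst_S n (\<lambda>j. if j = i then 1 else 0) =
    dst_conj n (\<lambda>m. of_real (csin n (int i * int m) / csin n (int m)))"
  using assms unfolding dst_S_eq
  by (simp add: if_distrib[of "\<lambda>x. x * _"] if_distrib[of "\<lambda>x. x / _"] cong: if_cong)

text \<open>In row 1 only l = 1 remains, with index k < n/2 and hence sign 1.\<close>

lemma dst_S_first_row:
  assumes "k \<in> {1..dst_dim n}"
  shows "dst_S n s $$ (0, k - 1) = s k"
proof -
  have k: "1 \<le> k" "2 * k < n"
    using assms by (auto simp: le_dst_dim_iff[OF n])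
  then have "sgn (real n / 2 - real k) = 1"
    by (simp add: sgn_if)
  moreover have "min (int n - int k) (int k) = int k"
    using k by linarith
  moreover have "\<bar>real k - 1\<bar> = real k - 1" "\<bar>int k - 1\<bar> = int k - 1"
    using k by simp_all
  moreover have "Suc (k - 1) = k" "k - 1 < dst_dim n" "0 < dst_dim n"
    using assms by auto
  ultimately show ?thesis
    using k unfolding dst_S_def by (simp add: algebra_simps)
qed

text \<open>The coefficients are the first row of \<open>dst_conj n d\<close>.\<close>

lemma ex_dst_S_eigenvalues:
  "\<exists>s. s 0 = 0 \<and> (\<forall>m\<in>{1..dst_dim n}.
    d m = (\<Sum>i = 1..dst_dim n. s i * complex_of_real (csin n (int i * int m) / csin n (int m))))"
proof -
  let ?I = "{1..dst_dim n}"
  define s where "s i = (\<Sum>m\<in>?I. complex_of_real (4 / real n) * (d m * complex_of_real (csin n (int m))) *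
    complex_of_real (csin n (int i * int m)))" for i
  have "(\<Sum>i\<in>?I. s i * complex_of_real (csin n (int i * int m) / csin n (int m))) = d m" if m: "m \<in> ?I" for m
  proof -
    have "(\<Sum>i\<in>?I. s i * complex_of_real (csin n (int i * int m) / csin n (int m))) =
      (\<Sum>m'\<in>?I. d m' * complex_of_real (csin n (int m')) * complex_of_real (4 / real n *
        (\<Sum>i\<in>?I. csin n (int m' * int i) * csin n (int m * int i)))) / complex_of_real (csin n (int m))"
      unfolding s_def sum_distrib_left sum_distrib_right of_real_sum sum_divide_distrib
      by (subst sum.swap) (simp add: mult_ac)
    also have "\<dots> = d m"
      using csin_nonzero[OF m] unfolding sum_csin_csin_complex[OF m] by simp
    finally show ?thesis .
  qed
  moreover have "s 0 = 0"
    by (simp add: s_def)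
  ultimately show ?thesis
    by (intro exI[of _ s]) simp
qed

lemma dst_algebra_eq_dst_S: "dst_algebra n = {dst_S n s |s. s 0 = 0}"
proof (intro equalityI subsetI)
  fix S assume "S \<in> dst_algebra n"
  then obtain d where S: "S = dst_conj n d"
    by (auto simp: dst_algebra_eq[OF n])
  obtain s where "s 0 = 0" "\<forall>m\<in>{1..dst_dim n}.
      d m = (\<Sum>i = 1..dst_dim n. s i * complex_of_real (csin n (int i * int m) / csin n (int m)))"
    using ex_dst_S_eigenvalues[of d] by blast
  then have "S = dst_S n s"
    unfolding S dst_S_eq by (intro dst_conj_cong) blast
  then show "S \<in> {dst_S n s |s. s 0 = 0}"
    using \<open>s 0 = 0\<close> by blast
qed (auto simp: dst_S_eq dst_algebra_eq[OF n])

text \<open>A linear relation with coefficients \<open>c\<close> says that \<open>dst_S n c\<close>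
  is zero, and the first row of that matrix is \<open>c\<close>.\<close>

lemma dst_algebra_basis_dst_S: "dst_algebra_basis n (\<lambda>i. dst_S n (\<lambda>j. if j = i then 1 else 0))"
proof (rule dst_algebra_basisI[OF n dst_S_delta])
  let ?e = "\<lambda>i m. complex_of_real (csin n (int i * int m) / csin n (int m))"
  fix c :: "nat \<Rightarrow> complex"
  assume "\<And>m. m \<in> {1..dst_dim n} \<Longrightarrow> (\<Sum>i = 1..dst_dim n. c i * ?e i m) = 0"
  then have "dst_S n c = dst_conj n (\<lambda>_. 0)"
    unfolding dst_S_eq by (intro dst_conj_cong)
  also have "\<dots> = dst_S n (\<lambda>_. 0)"
    by (simp add: dst_S_eq)
  finally show "\<forall>i\<in>{1..dst_dim n}. c i = 0"
    by (metis dst_S_first_row)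
next
  fix d
  show "\<exists>c. \<forall>m\<in>{1..dst_dim n}. d m =
      (\<Sum>i = 1..dst_dim n. c i * complex_of_real (csin n (int i * int m) / csin n (int m)))"
    using ex_dst_S_eigenvalues[of d] by blast
qed

text \<open>All eigenvalues are quotients of a sine by itself. The separate case is n <= 2, where
  the matrices are empty and 1 is no valid index for \<open>dst_S_delta\<close>.\<close>

lemma dst_S_one: "dst_S n (\<lambda>j. if j = 1 then 1 else 0) = 1\<^sub>m (dst_dim n)"
proof (cases "dst_dim n = 0")
  case True
  then show ?thesis
    by (intro eq_matI) (simp_all add: dst_S_def)
next
  case False
  then have "dst_S n (\<lambda>j. if j = 1 then 1 else 0) = dst_conj n (\<lambda>_. 1)"
    by (subst dst_S_delta) (auto intro!: dst_conj_cong simp: csin_nonzero)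
  then show ?thesis
    by (simp add: dst_conj_one[OF n])
qed

section \<open>The matrices $T_i$\<close>

text \<open>Since 0 < 2 i < n, the residues i and -i differ, so at most one of the two indicators is
  1.\<close>

lemma dst_x_eq:
  assumes "i \<in> {1..dst_dim n}"
  shows "dst_x n i a = of_bool (int n dvd a - int i) + of_bool (int n dvd a + int i)"
proof -
  have "\<not> (int n dvd a - int i \<and> int n dvd a + int i)"
    using dvd_diff[of "int n" "a + int i" "a - int i"] not_int_dvd_add[OF n, of i i] assms by auto
  moreover have "a mod int n = int i mod int n \<longleftrightarrow> int n dvd a - int i"
    "a mod int n = (- int i) mod int n \<longleftrightarrow> int n dvd a + int i"
    by (simp_all add: mod_eq_dvd_iff)
  ultimately show ?thesis
    unfolding dst_x_def dst_X_def by auto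
qed

text \<open>X_i is closed under negation. This links j - k in T_i with |j - k| in
  \<open>dst_general_T\<close>.\<close>

lemma dst_x_abs:
  assumes i: "i \<in> {1..dst_dim n}"
  shows "dst_x n i \<bar>a\<bar> = dst_x n i a"
proof -
  have "int n dvd - a - int i \<longleftrightarrow> int n dvd a + int i" "int n dvd - a + int i \<longleftrightarrow> int n dvd a - int i"
    using dvd_minus_iff[of "int n" "a + int i"] dvd_minus_iff[of "int n" "a - int i"] by simp_all
  then show ?thesis
    unfolding dst_x_eq[OF i] by (simp add: abs_if)
qed

text \<open>Of the four indicators in \<open>sum_ccos_csin_csin\<close>, the two positive ones make
  up the entry at j - k and the two negative ones that at j + k. The constants 4/n, 2 and n/8
  multiply to 1.\<close>

lemma dst_T_eq:
  assumes i: "i \<in> {1..dst_dim n}"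
  shows "dst_T n i = dst_conj n (\<lambda>m. 2 * of_real (ccos n (int i * int m)))"
  unfolding dst_T_def dst_conj_def
proof (rule mat1_eqI)
  fix j k
  have "(\<Sum>m = 1..dst_dim n. of_real (4 / real n) * (2 * of_real (ccos n (int i * int m))) *
      complex_of_real (csin n (int j * int m) * csin n (int k * int m))) =
    of_real (8 / real n * (\<Sum>m = 1..dst_dim n.
      ccos n (int i * int m) * csin n (int j * int m) * csin n (int k * int m)))"
    unfolding sum_distrib_left of_real_sum by (intro sum.cong refl) simp
  also have "\<dots> = of_bool (int n dvd int i + int j - int k) + of_bool (int n dvd int i - int j + int k)
      - of_bool (int n dvd int i + int j + int k) - of_bool (int n dvd int i - int j - int k)"
    using n unfolding sum_ccos_csin_csin[OF n] by simp
  also have "int n dvd int i - int j + int k \<longleftrightarrow> int n dvd int j - int k - int i"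
    using dvd_minus_iff[of "int n" "int i - int j + int k"] by (simp add: algebra_simps)
  also have "int n dvd int i - int j - int k \<longleftrightarrow> int n dvd int j + int k - int i"
    using dvd_minus_iff[of "int n" "int i - int j - int k"] by (simp add: algebra_simps)
  finally show "dst_x n i (int j - int k) - dst_x n i (int j + int k) =
    (\<Sum>m = 1..dst_dim n. of_real (4 / real n) * (2 * of_real (ccos n (int i * int m))) *
      complex_of_real (csin n (int j * int m) * csin n (int k * int m)))"
    unfolding dst_x_eq[OF i] by (simp add: algebra_simps)
qed

lemma dst_T_diagonalization:
  assumes "i \<in> {1..dst_dim n}"
  shows "dst_T n i = dst_mat n * dst_D n i * mat_adjoint (dst_mat n)"
proof -
  have "dst_D n i = mat_diag (dst_dim n) (\<lambda>m. 2 * of_real (ccos n (int i * int (Suc m))))"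
    by (intro eq_matI) (simp_all add: dst_D_def mat_diag_def ccos_def mult_ac)
  then show ?thesis
    using dst_conj_eq[OF n, of "\<lambda>m. 2 * of_real (ccos n (int i * int m))"]
    by (simp only: dst_T_eq[OF assms])
qed

lemma elements_dst_T: "elements_mat (dst_T n i) \<subseteq> \<real>"
  by (auto dest!: elements_matD simp: dst_T_def dst_x_def)

lemma transpose_dst_T:
  assumes "i \<in> {1..dst_dim n}"
  shows "transpose_mat (dst_T n i) = dst_T n i"
  unfolding dst_T_eq[OF assms]
  by (intro eq_matI) (simp_all add: dst_conj_def mult_ac)

text \<open>Equal cosines mean that i a and i b agree modulo n up to sign. If i is a unit it
  cancels, and distinct elements of 1..N are never congruent up to sign.\<close>

lemma dst_T_eigenvalues_distinct_iff:
  assumes i: "i \<in> {1..dst_dim n}"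
  shows "inj_on (\<lambda>m. 2 * complex_of_real (ccos n (int i * int m))) {1..dst_dim n} \<longleftrightarrow> coprime i n"
proof
  assume "coprime i n"
  then have cop: "coprime (int n) (int i)"
    by (simp add: coprime_commute)
  show "inj_on (\<lambda>m. 2 * complex_of_real (ccos n (int i * int m))) {1..dst_dim n}"
  proof (rule inj_onI)
    fix a b assume ab: "a \<in> {1..dst_dim n}" "b \<in> {1..dst_dim n}"
      "2 * complex_of_real (ccos n (int i * int a)) = 2 * of_real (ccos n (int i * int b))"
    then have "int n dvd int i * int a - int i * int b \<or> int n dvd int i * int a + int i * int b"
      by (simp add: ccos_eq_iff[OF n])
    then have "int n dvd int a - int b \<or> int n dvd int a + int b"
      unfolding right_diff_distrib[symmetric] distrib_left[symmetric] coprime_dvd_mult_right_iff[OF cop] .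
    then show "a = b"
      using ab int_dvd_diff_iff[OF n, of a b] not_int_dvd_add[OF n, of a b] by auto
  qed
next
  assume inj: "inj_on (\<lambda>m. 2 * complex_of_real (ccos n (int i * int m))) {1..dst_dim n}"
  show "coprime i n"
  proof (rule ccontr)
    assume "\<not> coprime i n"
    moreover define g where "g = gcd i n"
    ultimately have "g \<noteq> 1"
      by (simp add: coprime_iff_gcd_eq_1)
    moreover have "g \<noteq> 0"
      using n by (simp add: g_def)
    ultimately have g: "g \<ge> 2"
      by linarith
    obtain p q where pq: "i = g * p" "n = g * q"
      by (metis g_def gcd_dvd1 gcd_dvd2 dvdE)
    have "1 \<le> i" "2 * i < n"
      using i by (simp_all add: le_dst_dim_iff[OF n])
    then have "1 \<le> p" "g * (2 * p) < g * q"
      using pq by (auto simp: Suc_le_eq)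
    \<comment> \<open>From 2 p < q with p >= 1. Hence q - 1 differs from 1, while 2 q <= n keeps it
      within 1..N.\<close>
    then have q: "q \<ge> 3"
      by simp
    have "2 * q \<le> n"
      using g by (simp add: pq(2))
    then have "1 \<in> {1..dst_dim n}" "q - 1 \<in> {1..dst_dim n}"
      using q by (auto simp: le_dst_dim_iff[OF n])
    moreover have "ccos n (int i * int 1) = ccos n (int i * int (q - 1))"
    proof -
      \<comment> \<open>Since i q = n p, the residues i and i (q - 1) are opposite and have the same
        cosine.\<close>
      have "int i * int 1 + int i * int (q - 1) = int n * int p"
        using q by (simp add: pq of_nat_diff algebra_simps)
      then show ?thesis
        by (simp only: ccos_eq_iff[OF n]) simp
    qed
    ultimately have "1 = q - 1"
      by (intro inj_onD[OF inj]) simp_all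
    then show False
      using q by simp
  qed
qed

section \<open>Odd n: the basis of the T_i and the parametrization by t\<close>

lemma sum_dst_x:
  assumes "odd n" "t 0 = 0" "0 \<le> a" "a < int n"
  shows "(\<Sum>i = 1..dst_dim n. t i * dst_x n i a) = t (nat (min (int n - a) a))"
proof -
  define b where "b = nat (min (int n - a) a)"
  have b: "2 * b < n"
  proof -
    \<comment> \<open>Oddness excludes the residue n/2, so every a lies in a single X_b with 1 <= b
      <= N or is 0.\<close>
    have "2 * a \<noteq> int n"
      using assms(1) by presburger
    then show ?thesis
      using assms(3,4) unfolding b_def by linarith
  qed
  have x: "dst_x n i a = of_bool (i = b)" if i: "i \<in> {1..dst_dim n}" for i
  proof -
    have i': "1 \<le> i" "2 * i < n"
      using i by (auto simp: le_dst_dim_iff[OF n])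
    have "\<bar>a - int i\<bar> < int n" "\<bar>a + int i - int n\<bar> < int n"
      using i' assms(3,4) by linarith+
    then have "int n dvd a - int i \<longleftrightarrow> a = int i" "int n dvd a + int i - int n \<longleftrightarrow> a + int i = int n"
      using not_int_dvd_less[of "\<bar>a - int i\<bar>" n] not_int_dvd_less[of "\<bar>a + int i - int n\<bar>" n]
      by auto
    moreover have "int n dvd a + int i \<longleftrightarrow> int n dvd a + int i - int n"
      using dvd_add_triv_right_iff[of "int n" "a + int i - int n"] by simp
    ultimately show ?thesis
      using i' assms(3,4) unfolding dst_x_eq[OF i] b_def by auto
  qed
  have "(\<Sum>i = 1..dst_dim n. t i * dst_x n i a) = (\<Sum>i = 1..dst_dim n. if i = b then t i else 0)"
    using x by (intro sum.cong refl) simp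
  \<comment> \<open>For a = 0 no i matches and the sum is 0, which is the value of
    \<open>t 0\<close>.\<close>
  also have "\<dots> = t b"
    using assms(2) b by (cases "b = 0") (auto simp: le_dst_dim_iff[OF n])
  finally show ?thesis
    by (simp add: b_def)
qed

text \<open>The general form subtracts the term at |j - k| from that at j + k, the reverse of T_i;
  hence it is minus the combination of the T_i with coefficients t_i.\<close>

lemma dst_general_T_eq:
  assumes "odd n" "t 0 = 0"
  shows "dst_general_T n t =
    dst_conj n (\<lambda>m. \<Sum>i = 1..dst_dim n. - t i * (2 * of_real (ccos n (int i * int m))))"
proof (rule eq_matI)
  let ?N = "dst_dim n"
  fix j k assume "j < dim_row (dst_conj n (\<lambda>m. \<Sum>i = 1..?N. - t i * (2 * of_real (ccos n (int i * int m)))))"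
    "k < dim_col (dst_conj n (\<lambda>m. \<Sum>i = 1..?N. - t i * (2 * of_real (ccos n (int i * int m)))))"
  then have jk: "j < ?N" "k < ?N"
    by (simp_all add: carrier_matD[OF dst_conj_carrier])
  then have jk': "2 * int (Suc j) < int n" "2 * int (Suc k) < int n"
    using le_dst_dim_iff[OF n, of "Suc j"] le_dst_dim_iff[OF n, of "Suc k"] by linarith+
  have "dst_conj n (\<lambda>m. \<Sum>i = 1..?N. - t i * (2 * of_real (ccos n (int i * int m)))) $$ (j, k) =
    (\<Sum>i = 1..?N. - t i * dst_T n i $$ (j, k))"
    using jk dst_T_eq by (simp add: dst_conj_sum_index del: mult_minus_left)
  also have "\<dots> = (\<Sum>i = 1..?N. t i * dst_x n i (int (Suc j) + int (Suc k))) -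
      (\<Sum>i = 1..?N. t i * dst_x n i \<bar>int (Suc j) - int (Suc k)\<bar>)"
    unfolding sum_subtractf[symmetric]
  proof (intro sum.cong refl)
    fix i assume "i \<in> {1..?N}"
    with jk show "- t i * dst_T n i $$ (j, k) = t i * dst_x n i (int (Suc j) + int (Suc k)) -
        t i * dst_x n i \<bar>int (Suc j) - int (Suc k)\<bar>"
      by (simp only: dst_T_def index_mat1 dst_x_abs right_diff_distrib minus_mult_left[symmetric]) simp
  qed
  also have "\<dots> = dst_general_T n t $$ (j, k)"
  proof -
    have "(\<Sum>i = 1..?N. t i * dst_x n i (int (Suc j) + int (Suc k))) =
        t (nat (min (int n - (int (Suc j) + int (Suc k))) (int (Suc j) + int (Suc k))))"
      using jk' by (intro sum_dst_x[where t = t, OF assms]) auto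
    moreover have "(\<Sum>i = 1..?N. t i * dst_x n i \<bar>int (Suc j) - int (Suc k)\<bar>) =
        t (nat (min (int n - \<bar>int (Suc j) - int (Suc k)\<bar>) \<bar>int (Suc j) - int (Suc k)\<bar>))"
      using jk' by (intro sum_dst_x[where t = t, OF assms]) auto
    ultimately show ?thesis
      using jk by (simp only: dst_general_T_def index_mat1 diff_diff_eq)
  qed
  finally show "dst_general_T n t $$ (j, k) =
    dst_conj n (\<lambda>m. \<Sum>i = 1..?N. - t i * (2 * of_real (ccos n (int i * int m)))) $$ (j, k)" ..
qed (simp_all add: dst_general_T_def carrier_matD[OF dst_conj_carrier])

text \<open>For odd \<open>n\<close> the diagonal of \<open>dst_general_T n t\<close> already contains every \<open>t\<^sub>i\<close>: each \<open>i\<close> is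
  even or \<open>n - i\<close> is.\<close>

lemma dst_general_T_eq_0D:
  assumes "odd n" "t 0 = 0" "dst_general_T n t = dst_conj n (\<lambda>_. 0)" and i: "i \<in> {1..dst_dim n}"
  shows "t i = 0"
proof -
  define j where "j = (if even i then i div 2 else (n - i) div 2)"
  have i': "1 \<le> i" "2 * i < n"
    using i by (auto simp: le_dst_dim_iff[OF n])
  have "2 * j = i \<or> 2 * j = n - i"
    using assms(1) i' by (cases "even i") (simp_all add: j_def)
  then have j: "2 * int j = int i \<or> 2 * int j = int n - int i" "1 \<le> j" "2 * j < n"
    using i' by linarith+
  \<comment> \<open>The diagonal entry at j is \<open>t\<close> at this index minus
    \<open>t 0\<close>.\<close>
  have "min (int n - int j - int j) (int j + int j) = int i"
    using j i' by linarith
  moreover have "dst_general_T n t $$ (j - 1, j - 1) = 0"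
    using j assms(3) by (simp add: dst_conj_def le_dst_dim_iff[OF n] Suc_le_eq[symmetric])
  moreover have "Suc (j - 1) = j" "j - 1 < dst_dim n"
    using j by (simp_all add: le_dst_dim_iff[OF n] Suc_le_eq[symmetric])
  ultimately show ?thesis
    using assms(2) by (simp add: dst_general_T_def)
qed

text \<open>With \<open>g\<close> the even \<open>n\<close>-periodic function with Fourier coefficients \<open>d\<close>, the entries of
  \<open>dst_conj n d\<close> are \<open>g (j - k) - g (j + k)\<close>, so \<open>t = g 0 - g\<close> works.\<close>

lemma dst_conj_in_dst_general_T:
  assumes "odd n"
  obtains t where "t 0 = 0" "dst_conj n d = dst_general_T n t"
proof
  let ?I = "{1..dst_dim n}"
  \<comment> \<open>2/n is half of 4/n, because a product of sines is half a difference of cosines.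
    The constant g 0 cancels in the entries and serves to make \<open>t 0\<close> vanish.\<close>
  define g where "g a = (\<Sum>m\<in>?I. of_real (2 / real n) * d m * of_real (ccos n (a * int m)))" for a
  define t where "t i = g 0 - g (int i)" for i
  show "t 0 = 0"
    by (simp add: t_def)
  have t: "t (nat (min (int n - a) a)) = g 0 - g a" if "0 \<le> a" "a < int n" for a
  proof -
    have "ccos n ((int n - a) * int m) = ccos n (a * int m)" for m
      using n by (simp add: left_diff_distrib ccos_diff)
    then have "g (int n - a) = g a"
      by (simp add: g_def)
    then show ?thesis
      using that by (auto simp: t_def min_def)
  qed
  show "dst_conj n d = dst_general_T n t"
    unfolding dst_conj_def dst_general_T_def
  proof (rule mat1_eqI)
    fix j k assume "1 \<le> j" "j \<le> dst_dim n" "1 \<le> k" "k \<le> dst_dim n"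
    then have jk: "2 * j < n" "2 * k < n"
      by (auto simp: le_dst_dim_iff[OF n])
    have "ccos n (\<bar>int j - int k\<bar> * int m) = ccos n ((int j - int k) * int m)" for m
      using ccos_minus[of n "(int j - int k) * int m"] by (simp add: abs_if algebra_simps)
    then have g_abs: "g \<bar>int j - int k\<bar> = g (int j - int k)"
      by (simp add: g_def)
    have scale: "of_real (4 / real n) * x * of_real ((A - B) / 2) =
        of_real (2 / real n) * x * of_real A - of_real (2 / real n) * x * complex_of_real B" for A B x
      using n by (simp add: field_simps)
    have "(\<Sum>m\<in>?I. of_real (4 / real n) * d m * of_real (csin n (int j * int m) * csin n (int k * int m))) =
      g (int j - int k) - g (int j + int k)"
      unfolding g_def sum_subtractf[symmetric] csin_times_csin left_diff_distrib[symmetric]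
        distrib_right[symmetric] scale ..
    moreover have "t (nat (min (int n - (int j + int k)) (int j + int k))) = g 0 - g (int j + int k)"
      using jk by (intro t) linarith+
    moreover have "t (nat (min (int n - \<bar>int j - int k\<bar>) \<bar>int j - int k\<bar>)) = g 0 - g \<bar>int j - int k\<bar>"
      using jk by (intro t) linarith+
    ultimately show "(\<Sum>m\<in>?I. of_real (4 / real n) * d m * of_real (csin n (int j * int m) * csin n (int k * int m))) =
      t (nat (min (int n - int j - int k) (int j + int k))) -
      t (nat (min (int n - \<bar>int j - int k\<bar>) \<bar>int j - int k\<bar>))"
      by (simp add: diff_diff_eq g_abs)
  qed
qed

lemma dst_algebra_eq_dst_general_T:
  assumes "odd n"
  shows "dst_algebra n = {dst_general_T n t |t. t 0 = 0}"
proof (intro equalityI subsetI)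
  fix S assume "S \<in> dst_algebra n"
  then obtain d where "S = dst_conj n d"
    by (auto simp: dst_algebra_eq[OF n])
  then show "S \<in> {dst_general_T n t |t. t 0 = 0}"
    using dst_conj_in_dst_general_T[OF assms, of d] by blast
qed (auto simp: dst_general_T_eq[OF assms] dst_algebra_eq[OF n])

lemma dst_algebra_basis_dst_T:
  assumes odd: "odd n"
  shows "dst_algebra_basis n (dst_T n)"
proof (rule dst_algebra_basisI[OF n dst_T_eq])
  let ?N = "dst_dim n" and ?e = "\<lambda>i m. 2 * complex_of_real (ccos n (int i * int m))"
  fix c :: "nat \<Rightarrow> complex"
  assume c: "\<And>m. m \<in> {1..?N} \<Longrightarrow> (\<Sum>i = 1..?N. c i * ?e i m) = 0"
  \<comment> \<open>The relation involves \<open>c\<close> on 1..N only; resetting it at 0 meets the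
    convention t_0 = 0.\<close>
  define t where "t = c(0 := 0)"
  have "t 0 = 0"
    by (simp add: t_def)
  have "dst_general_T n t = dst_conj n (\<lambda>_. 0)"
    unfolding dst_general_T_eq[where t = t, OF odd \<open>t 0 = 0\<close>]
  proof (rule dst_conj_cong)
    fix m assume "m \<in> {1..?N}"
    then show "(\<Sum>i = 1..?N. - t i * ?e i m) = 0"
      using c[of m] unfolding mult_minus_left sum_negf by (simp add: t_def cong: sum.cong_simp)
  qed
  then have "\<forall>i\<in>{1..?N}. t i = 0"
    using dst_general_T_eq_0D[where t = t, OF odd \<open>t 0 = 0\<close>] by blast
  then show "\<forall>i\<in>{1..?N}. c i = 0"
    by (simp add: t_def)
next
  let ?N = "dst_dim n" and ?e = "\<lambda>i m. 2 * complex_of_real (ccos n (int i * int m))"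
  fix d
  obtain t where t: "t 0 = 0" "dst_conj n d = dst_general_T n t"
    by (rule dst_conj_in_dst_general_T[OF odd])
  then have "\<forall>m\<in>{1..?N}. d m = (\<Sum>i = 1..?N. - t i * ?e i m)"
    by (simp only: dst_general_T_eq[where t = t, OF odd t(1)] dst_conj_eq_iff[OF n])
  then show "\<exists>c. \<forall>m\<in>{1..?N}. d m = (\<Sum>i = 1..?N. c i * ?e i m)"
    by (rule exI[of _ "\<lambda>i. - t i"])
qed

end

theorem theorem21:
  fixes n :: nat
  assumes "n \<ge> 3"
  shows "(dst_algebra n = {dst_S n s |s. s 0 = 0} \<and>
      (\<forall>s. s 0 = 0 \<longrightarrow> (\<forall>k\<in>{1..dst_dim n}. dst_S n s $$ (0, k - 1) = s k)) \<and>
      dst_algebra_basis n (\<lambda>i. dst_S n (\<lambda>j. if j = i then 1 else 0)) \<and>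
      dst_S n (\<lambda>j. if j = 1 then 1 else 0) = 1\<^sub>m (dst_dim n)) \<and>
    (\<forall>i\<in>{1..dst_dim n}.
      elements_mat (dst_T n i) \<subseteq> \<real> \<and>
      transpose_mat (dst_T n i) = dst_T n i \<and>
      dst_T n i = dst_mat n * dst_D n i * mat_adjoint (dst_mat n) \<and>
      (generated_algebra (dst_dim n) (dst_T n i) = dst_algebra n \<longleftrightarrow> coprime i n)) \<and>
    (odd n \<longrightarrow>
      dst_algebra_basis n (dst_T n) \<and>
      dst_algebra n = {dst_general_T n t |t. t 0 = 0})"
proof -
  have n: "n > 0"
    using assms by simp
  have "generated_algebra (dst_dim n) (dst_T n i) = dst_algebra n \<longleftrightarrow> coprime i n"
    if "i \<in> {1..dst_dim n}" for i
    by (simp only: dst_T_eq[OF n that] generated_algebra_eq_dst_algebra_iff[OF n]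
      dst_T_eigenvalues_distinct_iff[OF n that])
  then show ?thesis
    using n by (intro conjI ballI allI impI dst_algebra_eq_dst_S dst_S_first_row dst_algebra_basis_dst_S
      dst_S_one elements_dst_T transpose_dst_T dst_T_diagonalization dst_algebra_basis_dst_T
      dst_algebra_eq_dst_general_T)
qed

end
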